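(* Let $n\in\mathbb{N}$ and suppose that $A=(a_{ij}),B=(b_{ij})\in M_n(\mathbb{R})$ are $n$ by $n$ matrices with nonnegative entries such that every Alexandrov space of nonnegative curvature satisfies the $(A,B)$-quadratic metric inequality. Then for every metric space $(X,d_X)$ and every $x_1,\dots,x_n\in X$ we have $$\sum_{i=1}^n\sum_{j=1}^n a_{ij}d_X(x_i,x_j)\le\sum_{i=1}^n\sum_{j=1}^n b_{ij}d_X(x_i,x_j).$$
   Context: A metric space $(Y,d_Y)$ satisfies the $(A,B)$-quadratic metric inequality if for every $y_1,\dots,y_n\in Y$ one has $\sum_{i,j=1}^n a_{ij}d_Y(y_i,y_j)^2\le\sum_{i,j=1}^n b_{ij}d_Y(y_i,y_j)^2$. A complete geodesic metric space $(Y,d_Y)$ is an Alexandrov space of nonnegative curvature if for every $x,y,z\in Y$ and every metric midpoint $w$ of $x,y$ (i.e. $d_Y(x,w)=d_Y(y,w)=d_Y(x,y)/2$) one has $d_Y(x,y)^2+4d_Y(z,w)^2\ge 2d_Y(x,z)^2+2d_Y(y,z)^2$. *)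

theory Defs
  imports "HOL-Analysis.Analysis"
begin

definition quadratic_metric_inequality ::
    "real ^ 'n ^ 'n \<Rightarrow> real ^ 'n ^ 'n \<Rightarrow> 'a set \<Rightarrow> ('a \<Rightarrow> 'a \<Rightarrow> real) \<Rightarrow> bool" where
  "quadratic_metric_inequality A B M d \<longleftrightarrow>
     (\<forall>y :: 'n \<Rightarrow> 'a. range y \<subseteq> M \<longrightarrow>
        (\<Sum>i\<in>UNIV. \<Sum>j\<in>UNIV. A $ i $ j * (d (y i) (y j))\<^sup>2)
        \<le> (\<Sum>i\<in>UNIV. \<Sum>j\<in>UNIV. B $ i $ j * (d (y i) (y j))\<^sup>2))"

definition geodesic_metric_space :: "'a set \<Rightarrow> ('a \<Rightarrow> 'a \<Rightarrow> real) \<Rightarrow> bool" where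
  "geodesic_metric_space M d \<longleftrightarrow> Metric_space M d \<and>
     (\<forall>x\<in>M. \<forall>y\<in>M. \<exists>g :: real \<Rightarrow> 'a.
        g ` {0..d x y} \<subseteq> M \<and> g 0 = x \<and> g (d x y) = y \<and>
        (\<forall>s\<in>{0..d x y}. \<forall>t\<in>{0..d x y}. d (g s) (g t) = \<bar>s - t\<bar>))"

definition metric_midpoint :: "('a \<Rightarrow> 'a \<Rightarrow> real) \<Rightarrow> 'a \<Rightarrow> 'a \<Rightarrow> 'a \<Rightarrow> bool" where
  "metric_midpoint d x y w \<longleftrightarrow> d x w = d x y / 2 \<and> d y w = d x y / 2"

definition alexandrov_nonneg_curved :: "'a set \<Rightarrow> ('a \<Rightarrow> 'a \<Rightarrow> real) \<Rightarrow> bool" where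
  "alexandrov_nonneg_curved M d \<longleftrightarrow>
     Metric_space M d \<and> Metric_space.mcomplete M d \<and> geodesic_metric_space M d \<and>
     (\<forall>x\<in>M. \<forall>y\<in>M. \<forall>z\<in>M. \<forall>w\<in>M. metric_midpoint d x y w \<longrightarrow>
        (d x y)\<^sup>2 + 4 * (d z w)\<^sup>2 \<ge> 2 * (d x z)\<^sup>2 + 2 * (d y z)\<^sup>2)"

text \<open>
  A formula of HOL cannot quantify over all types, so ``every Alexandrov space'' is rendered by
  letting the carrier range over all sets of reals, each with an arbitrary metric unrelated to
  the usual one: up to isometry these are all the spaces of cardinality at most the continuum.
  Since this predicate is used as a hypothesis, the restriction on cardinality can only
  strengthen a theorem. Mathematically it changes nothing: finitely many points of an arbitrary
  such space lie in a complete geodesic subset of cardinality at most the continuum (close up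
  \<open>\<omega>\<^sub>1\<close> times under a choice of geodesics and under limits of sequences), and
  such a subset inherits the curvature condition, and the quadratic inequality for a tuple
  involves only the points of that tuple.
\<close>

definition alexandrov_quadratic_inequality :: "real ^ 'n ^ 'n \<Rightarrow> real ^ 'n ^ 'n \<Rightarrow> bool" where
  "alexandrov_quadratic_inequality A B \<longleftrightarrow>
     (\<forall>(M :: real set) (d :: real \<Rightarrow> real \<Rightarrow> real).
        alexandrov_nonneg_curved M d \<longrightarrow> quadratic_metric_inequality A B M d)"

end

theory Submission
  imports Defs
begin

text \<open>
  A square root of a finite metric embeds, with arbitrarily small distortion, into a suitable space
  of nonnegative curvature; applying the quadratic inequality there and letting the distortion tend
  to zero gives the linear inequality for the metric itself.

  The spaces are quotients of Euclidean spaces by finite permutation groups: their points are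
  configurations of finitely many indistinguishable particles, and their squared distance is the least
  total squared displacement of a matching of two configurations. They are nonnegatively curved because
  quotients by finite groups of isometries inherit this property (\<open>alexandrov_quotient\<close>), and
  their cardinality is at most that of the reals.

  All configurations in use consist of one common background and a single additional particle. A particle
  at the beginning of a chain of background points is moved to its end by shifting every particle of the
  chain by one place (\<open>config_dist_le_chain\<close>), at the price of the sum of the squared
  step lengths. Conversely, a function on the background that varies by at most the squared Euclidean
  distance bounds the price from below (\<open>potential_le_config_dist\<close>). Hence the squared
  distance is a shortest path metric, provided that no shortcut between background points is cheaper than
  the way along the chains.

  Let the metric have integer values \<open>m i j\<close>. The chain from \<open>i\<close> to \<open>j\<close>
  has \<open>2 * m i j\<close> steps of length about 1. Its points have a component in a large simplex, which
  keeps the different nodes apart, and a component in a cube private to the chain, in which the chain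
  runs through a closed loop whose squared Euclidean distances are the distances along the loop.
  Together they exclude shortcuts (\<open>path_dist_diff_le\<close>), and the particle configurations at
  \<open>i\<close> and \<open>j\<close> have squared distance between \<open>2 * m i j\<close> and
  \<open>2 * m i j + 12 * Mx / m i j\<close>, where \<open>Mx\<close> bounds \<open>m\<close>. An arbitrary
  finite metric is multiplied by \<open>k\<^sup>2\<close> and rounded to such an \<open>m\<close>; after
  division by \<open>2 * k\<^sup>2\<close> the error is of order \<open>1 / k\<close>.
\<close>

section \<open>Spaces of functions as spaces of reals\<close>

text \<open>
  The curvature hypothesis speaks about spaces whose points are real numbers. A sequence of reals
  has no more information than a set of naturals, so the function spaces used below embed into
  \<open>real\<close>.
\<close>

lemma inj_countable_fun_real: "\<exists>h :: ('i::countable \<Rightarrow> real) \<Rightarrow> real. inj h"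
proof -
  obtain e :: "real \<Rightarrow> nat set" where e: "inj e"
    using nat_sets_eqpoll_reals eqpoll_imp_lepoll eqpoll_sym unfolding lepoll_def by blast
  obtain c :: "nat set \<Rightarrow> real" where c: "inj c"
    using nat_sets_eqpoll_reals eqpoll_imp_lepoll unfolding lepoll_def by blast
  define F :: "('i \<Rightarrow> real) \<Rightarrow> nat set" where
    "F u = {to_nat (i, n) |i n. n \<in> e (u i)}" for u
  have F: "to_nat (i, n) \<in> F u \<longleftrightarrow> n \<in> e (u i)" for u i n
    unfolding F_def by auto
  have "inj F"
  proof (rule injI)
    fix u v assume "F u = F v"
    hence "e (u i) = e (v i)" for i
      using F[of i _ u] F[of i _ v] by auto
    thus "u = v" using e by (auto simp: fun_eq_iff inj_eq)
  qed
  hence "inj (c \<circ> F)" using c by (rule inj_compose[rotated])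
  thus ?thesis by blast
qed

lemma alexandrov_isometric_copy:
  fixes h :: "'a \<Rightarrow> 'b"
  assumes h: "inj h" and alex: "alexandrov_nonneg_curved M d"
  shows "alexandrov_nonneg_curved (h ` M) (\<lambda>a b. d (inv h a) (inv h b))"
proof -
  let ?d = "\<lambda>a b. d (inv h a) (inv h b)"
  have ih[simp]: "inv h (h u) = u" for u using h by simp
  have ms: "Metric_space M d" and compl: "Metric_space.mcomplete M d"
    and geo: "geodesic_metric_space M d"
    and curv: "\<And>x y z w. \<lbrakk>x \<in> M; y \<in> M; z \<in> M; w \<in> M; metric_midpoint d x y w\<rbrakk> \<Longrightarrow>
        (d x y)\<^sup>2 + 4 * (d z w)\<^sup>2 \<ge> 2 * (d x z)\<^sup>2 + 2 * (d y z)\<^sup>2"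
    using alex unfolding alexandrov_nonneg_curved_def by blast+
  interpret M: Metric_space M d by (rule ms)
  interpret N: Metric_space "h ` M" ?d
  proof
    show "0 \<le> ?d a b" for a b by (rule M.nonneg)
    show "?d a b = ?d b a" for a b by (rule M.commute)
    show "?d a b = 0 \<longleftrightarrow> a = b" if "a \<in> h ` M" "b \<in> h ` M" for a b
      using that by (elim imageE) (simp only: ih M.zero inj_eq[OF h])
    show "?d a c \<le> ?d a b + ?d b c" if "a \<in> h ` M" "b \<in> h ` M" "c \<in> h ` M" for a b c
      using that by (elim imageE) (simp only: ih M.triangle)
  qed
  have cN: "N.mcomplete"
    unfolding N.mcomplete_def
  proof (intro allI impI)
    fix \<sigma> assume \<sigma>: "N.MCauchy \<sigma>"
    have im: "\<sigma> n \<in> h ` M" for n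
      using \<sigma> unfolding N.MCauchy_def by blast
    have im': "inv h (\<sigma> n) \<in> M" for n
      using im[of n] by (elim imageE) simp
    have "M.MCauchy (\<lambda>n. inv h (\<sigma> n))"
      using \<sigma> im' unfolding M.MCauchy_def N.MCauchy_def by blast
    then obtain l where "limitin M.mtopology (\<lambda>n. inv h (\<sigma> n)) l sequentially"
      using compl unfolding M.mcomplete_def by blast
    hence "limitin N.mtopology \<sigma> (h l) sequentially"
      using im im' unfolding M.limit_metric_sequentially N.limit_metric_sequentially by simp
    thus "\<exists>x. limitin N.mtopology \<sigma> x sequentially" ..
  qed
  have gN: "geodesic_metric_space (h ` M) ?d"
    unfolding geodesic_metric_space_def
  proof (intro conjI ballI)
    show "Metric_space (h ` M) ?d" by (rule N.Metric_space_axioms)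
    fix a b assume "a \<in> h ` M" "b \<in> h ` M"
    then obtain x y where ab: "a = h x" "b = h y" "x \<in> M" "y \<in> M" by blast
    then obtain g where "g ` {0..d x y} \<subseteq> M" "g 0 = x" "g (d x y) = y"
        "\<forall>s\<in>{0..d x y}. \<forall>t\<in>{0..d x y}. d (g s) (g t) = \<bar>s - t\<bar>"
      using geo unfolding geodesic_metric_space_def by blast
    thus "\<exists>g. g ` {0..?d a b} \<subseteq> h ` M \<and> g 0 = a \<and> g (?d a b) = b \<and>
        (\<forall>s\<in>{0..?d a b}. \<forall>t\<in>{0..?d a b}. ?d (g s) (g t) = \<bar>s - t\<bar>)"
      by (intro exI[of _ "h \<circ> g"]) (auto simp: ab)
  qed
  have "(?d a b)\<^sup>2 + 4 * (?d c w)\<^sup>2 \<ge> 2 * (?d a c)\<^sup>2 + 2 * (?d b c)\<^sup>2"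
    if "a \<in> h ` M" "b \<in> h ` M" "c \<in> h ` M" "w \<in> h ` M" "metric_midpoint ?d a b w" for a b c w
    using that by (auto simp: metric_midpoint_def intro!: curv)
  thus ?thesis
    unfolding alexandrov_nonneg_curved_def using N.Metric_space_axioms cN gN by blast
qed

text \<open>
  Curvature is an isometry invariant, so the hypothesis on spaces of reals carries over to every
  space whose points are real functions on a countable index type.
\<close>

lemma alexandrov_quadratic_inequality_fun_spaces:
  fixes M :: "('i::countable \<Rightarrow> real) set"
  assumes AB: "alexandrov_quadratic_inequality A B"
    and alex: "alexandrov_nonneg_curved M d"
  shows "quadratic_metric_inequality A B M d"
proof -
  obtain h :: "('i \<Rightarrow> real) \<Rightarrow> real" where h: "inj h"
    using inj_countable_fun_real by blast
  have ih[simp]: "inv h (h u) = u" for u using h by simp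
  have q: "quadratic_metric_inequality A B (h ` M) (\<lambda>a b. d (inv h a) (inv h b))"
    using AB alexandrov_isometric_copy[OF h alex] unfolding alexandrov_quadratic_inequality_def
    by blast
  show ?thesis
    unfolding quadratic_metric_inequality_def
  proof (intro allI impI)
    fix y :: "'a \<Rightarrow> 'i \<Rightarrow> real" assume "range y \<subseteq> M"
    hence "range (h \<circ> y) \<subseteq> h ` M" by auto
    with q show "(\<Sum>i\<in>UNIV. \<Sum>j\<in>UNIV. A $ i $ j * (d (y i) (y j))\<^sup>2)
        \<le> (\<Sum>i\<in>UNIV. \<Sum>j\<in>UNIV. B $ i $ j * (d (y i) (y j))\<^sup>2)"
      unfolding quadratic_metric_inequality_def by (force dest: spec[of _ "h \<circ> y"])
  qed
qed


section \<open>Euclidean spaces\<close>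

text \<open>
  \<open>\<real>\<^sup>I\<close> as the set of functions that vanish off \<open>I\<close>. The dimension
  needed later grows with the precision of the approximation, so it cannot sit in a type.
\<close>

definition euclid :: "'i set \<Rightarrow> ('i \<Rightarrow> real) set" where
  "euclid I = {u. \<forall>i. i \<notin> I \<longrightarrow> u i = 0}"

definition euclid_dist :: "'i set \<Rightarrow> ('i \<Rightarrow> real) \<Rightarrow> ('i \<Rightarrow> real) \<Rightarrow> real" where
  "euclid_dist I u v = L2_set (\<lambda>i. u i - v i) I"

lemma euclid_dist_sq: "(euclid_dist I u v)\<^sup>2 = (\<Sum>i\<in>I. (u i - v i)\<^sup>2)"
  unfolding euclid_dist_def L2_set_def by (simp add: sum_nonneg)

lemma Metric_space_euclid:
  assumes "finite I"
  shows "Metric_space (euclid I) (euclid_dist I)"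
proof
  fix x y z :: "'a \<Rightarrow> real"
  show "0 \<le> euclid_dist I x y" by (simp add: euclid_dist_def)
  show "euclid_dist I x y = euclid_dist I y x"
    by (simp add: euclid_dist_def L2_set_def power2_commute)
  show "euclid_dist I x y = 0 \<longleftrightarrow> x = y" if "x \<in> euclid I" "y \<in> euclid I"
  proof
    assume "euclid_dist I x y = 0"
    hence "x i = y i" if "i \<in> I" for i
      using that assms by (simp add: euclid_dist_def L2_set_eq_0_iff)
    moreover have "x i = y i" if "i \<notin> I" for i
      using that \<open>x \<in> euclid I\<close> \<open>y \<in> euclid I\<close> by (simp add: euclid_def)
    ultimately show "x = y" by blast
  qed (simp add: euclid_dist_def L2_set_def)
  show "euclid_dist I x z \<le> euclid_dist I x y + euclid_dist I y z"
    using L2_set_triangle_ineq[of "\<lambda>i. x i - y i" "\<lambda>i. y i - z i" I] by (simp add: euclid_dist_def)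
qed

lemma mcomplete_euclid:
  assumes I: "finite I"
  shows "Metric_space.mcomplete (euclid I) (euclid_dist I)"
proof -
  interpret Metric_space "euclid I" "euclid_dist I" by (rule Metric_space_euclid[OF I])
  show ?thesis
    unfolding mcomplete_def
  proof (intro allI impI)
    fix \<sigma> assume \<sigma>: "MCauchy \<sigma>"
    have "Cauchy (\<lambda>n. \<sigma> n i)" if i: "i \<in> I" for i
    proof (rule metric_CauchyI)
      fix e :: real assume "0 < e"
      then obtain N where N: "\<And>n n'. \<lbrakk>N \<le> n; N \<le> n'\<rbrakk> \<Longrightarrow> euclid_dist I (\<sigma> n) (\<sigma> n') < e"
        using \<sigma> unfolding MCauchy_def by blast
      have "dist (\<sigma> m i) (\<sigma> n i) < e" if "N \<le> m" "N \<le> n" for m n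
      proof -
        have "\<bar>\<sigma> m i - \<sigma> n i\<bar> \<le> L2_set (\<lambda>i. \<bar>\<sigma> m i - \<sigma> n i\<bar>) I"
          using member_le_L2_set[OF I i, of "\<lambda>i. \<bar>\<sigma> m i - \<sigma> n i\<bar>"] .
        also have "\<dots> = euclid_dist I (\<sigma> m) (\<sigma> n)"
          by (simp add: euclid_dist_def L2_set_def)
        finally show ?thesis using N[OF that] by (simp add: dist_real_def)
      qed
      thus "\<exists>M. \<forall>m\<ge>M. \<forall>n\<ge>M. dist (\<sigma> m i) (\<sigma> n i) < e" by blast
    qed
    hence lim: "(\<lambda>n. \<sigma> n i) \<longlonglongrightarrow> lim (\<lambda>n. \<sigma> n i)" if "i \<in> I" for i
      using that Cauchy_convergent convergent_LIMSEQ_iff by blast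
    define l where "l i = (if i \<in> I then lim (\<lambda>n. \<sigma> n i) else 0)" for i
    have "(\<lambda>n. euclid_dist I (\<sigma> n) l) \<longlonglongrightarrow> sqrt (\<Sum>i\<in>I. (l i - l i)\<^sup>2)"
      unfolding euclid_dist_def L2_set_def using lim
      by (intro tendsto_real_sqrt tendsto_sum tendsto_power tendsto_diff tendsto_const)
        (simp add: l_def)
    moreover have "l \<in> euclid I" by (simp add: l_def euclid_def)
    moreover have "\<sigma> n \<in> euclid I" for n using \<sigma> unfolding MCauchy_def by blast
    ultimately show "\<exists>x. limitin mtopology \<sigma> x sequentially"
      by (auto simp: limitin_metric_dist_null)
  qed
qed

lemma geodesic_euclid:
  assumes I: "finite I"
  shows "geodesic_metric_space (euclid I) (euclid_dist I)"
proof -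
  interpret Metric_space "euclid I" "euclid_dist I" by (rule Metric_space_euclid[OF I])
  show ?thesis
    unfolding geodesic_metric_space_def
  proof (intro conjI ballI)
    show "Metric_space (euclid I) (euclid_dist I)" by (rule Metric_space_axioms)
    fix x y assume xy: "x \<in> euclid I" "y \<in> euclid I"
    define L where "L = euclid_dist I x y"
    define g where "g t = (\<lambda>i. x i + (t / L) * (y i - x i))" for t
    have dg: "euclid_dist I (g s) (g t) = \<bar>s - t\<bar>" if "s \<in> {0..L}" "t \<in> {0..L}" for s t
    proof (cases "L = 0")
      case True
      thus ?thesis using that by (simp add: g_def euclid_dist_def L2_set_def)
    next
      case False
      hence L: "L > 0" using nonneg[of x y] unfolding L_def by linarith
      have "g s i - g t i = ((t - s) / L) * (x i - y i)" for i
        using L by (simp add: g_def field_simps)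
      hence "(euclid_dist I (g s) (g t))\<^sup>2 = ((t - s) / L)\<^sup>2 * L\<^sup>2"
        unfolding L_def euclid_dist_sq by (simp add: power_mult_distrib power_divide sum_distrib_left)
      also have "\<dots> = (t - s)\<^sup>2" using L by (simp add: power_divide)
      finally show ?thesis
        by (metis abs_minus_commute abs_mdist power2_abs power2_eq_iff_nonneg abs_ge_zero nonneg)
    qed
    have "g ` {0..L} \<subseteq> euclid I" using xy by (auto simp: g_def euclid_def)
    moreover have "g 0 = x" by (simp add: g_def)
    moreover have "g L = y"
    proof (cases "L = 0")
      case True
      hence "x = y" using xy unfolding L_def by simp
      thus ?thesis by (simp add: g_def)
    qed (simp add: g_def)
    ultimately show "\<exists>g. g ` {0..euclid_dist I x y} \<subseteq> euclid I \<and> g 0 = x \<and> g (euclid_dist I x y) = y \<and>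
        (\<forall>s\<in>{0..euclid_dist I x y}. \<forall>t\<in>{0..euclid_dist I x y}. euclid_dist I (g s) (g t) = \<bar>s - t\<bar>)"
      using dg unfolding L_def by blast
  qed
qed

text \<open>
  By the parallelogram law a metric midpoint is the affine midpoint, and then the curvature condition
  holds coordinate by coordinate, with equality.
\<close>

lemma alexandrov_euclid:
  assumes I: "finite I"
  shows "alexandrov_nonneg_curved (euclid I) (euclid_dist I)"
  unfolding alexandrov_nonneg_curved_def
proof (intro conjI ballI impI)
  let ?d = "euclid_dist I"
  fix x y z w assume mid: "metric_midpoint ?d x y w"
  have p: "(\<Sum>i\<in>I. (x i + y i - 2 * w i)\<^sup>2) + (?d x y)\<^sup>2 = 2 * (?d x w)\<^sup>2 + 2 * (?d y w)\<^sup>2"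
    unfolding euclid_dist_sq sum_distrib_left sum.distrib[symmetric]
    by (intro sum.cong refl) (simp add: power2_eq_square algebra_simps)
  have "(\<Sum>i\<in>I. (x i + y i - 2 * w i)\<^sup>2) = 0"
  proof -
    have "(?d x w)\<^sup>2 = (?d x y)\<^sup>2 / 4" "(?d y w)\<^sup>2 = (?d x y)\<^sup>2 / 4"
      using mid unfolding metric_midpoint_def by (simp_all only: power_divide) simp_all
    thus ?thesis using p by linarith
  qed
  hence w: "w i = (x i + y i) / 2" if "i \<in> I" for i
    using I that by (simp add: sum_nonneg_eq_0_iff)
  have "2 * (?d x z)\<^sup>2 + 2 * (?d y z)\<^sup>2 = (?d x y)\<^sup>2 + 4 * (?d z w)\<^sup>2"
    unfolding euclid_dist_sq sum_distrib_left sum.distrib[symmetric]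
    by (intro sum.cong refl) (simp add: w power2_eq_square field_simps)
  thus "2 * (?d x z)\<^sup>2 + 2 * (?d y z)\<^sup>2 \<le> (?d x y)\<^sup>2 + 4 * (?d z w)\<^sup>2" by simp
qed (use Metric_space_euclid mcomplete_euclid geodesic_euclid I in blast)+


section \<open>Quotients by finite groups of isometries\<close>

text \<open>
  Quotients of nonnegatively curved spaces by finite groups of isometries. The maps in \<open>G\<close>
  only matter on \<open>E\<close>, so composition and inversion are required there alone. Points of the
  quotient are represented by chosen elements of the orbits, which keeps the quotient inside the
  type of \<open>E\<close>.
\<close>

locale finite_isometry_action = Metric_space E \<rho> for E :: "'a set" and \<rho> +
  fixes G :: "('a \<Rightarrow> 'a) set"
  assumes fin: "finite G"
    and idG: "id \<in> G"
    and closed: "\<lbrakk>g \<in> G; x \<in> E\<rbrakk> \<Longrightarrow> g x \<in> E"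
    and comp: "\<lbrakk>g \<in> G; h \<in> G\<rbrakk> \<Longrightarrow> \<exists>k\<in>G. \<forall>x\<in>E. k x = g (h x)"
    and inverse: "g \<in> G \<Longrightarrow> \<exists>k\<in>G. \<forall>x\<in>E. k (g x) = x"
    and isometry: "\<lbrakk>g \<in> G; x \<in> E; y \<in> E\<rbrakk> \<Longrightarrow> \<rho> (g x) (g y) = \<rho> x y"
begin

definition orb :: "'a \<Rightarrow> 'a set" where "orb u = (\<lambda>g. g u) ` G"

definition orb_rep :: "'a \<Rightarrow> 'a" where "orb_rep u = (SOME v. v \<in> orb u)"

text \<open>
  Minimising over both orbits, although fixing one point would give the same value on
  \<open>E\<close>, makes the distance symmetric on the whole type, as the locale
  \<open>Metric_space\<close> demands.
\<close>

definition orb_dist :: "'a \<Rightarrow> 'a \<Rightarrow> real" where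
  "orb_dist u v = Min ((\<lambda>(a, b). \<rho> a b) ` (orb u \<times> orb v))"

lemma orb_self: "u \<in> orb u"
  using idG unfolding orb_def by (metis id_apply image_eqI)

lemma finite_orb: "finite (orb u)"
  using fin unfolding orb_def by simp

lemma orb_subset: "\<lbrakk>u \<in> E; a \<in> orb u\<rbrakk> \<Longrightarrow> a \<in> E"
  unfolding orb_def using closed by blast

lemma orb_trans: "\<lbrakk>u \<in> E; a \<in> orb u; b \<in> orb a\<rbrakk> \<Longrightarrow> b \<in> orb u"
  unfolding orb_def using comp by (smt (verit) image_iff)

lemma orb_sym: "\<lbrakk>u \<in> E; a \<in> orb u\<rbrakk> \<Longrightarrow> u \<in> orb a"
  unfolding orb_def using inverse by (smt (verit) image_iff)

lemma orb_eq: "\<lbrakk>u \<in> E; a \<in> orb u\<rbrakk> \<Longrightarrow> orb a = orb u"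
  by (meson orb_subset orb_sym orb_trans subsetI subset_antisym)

lemma orb_rep_in_orb: "orb_rep u \<in> orb u"
  unfolding orb_rep_def using orb_self by (rule someI)

lemma orb_rep_closed: "u \<in> E \<Longrightarrow> orb_rep u \<in> E"
  using orb_subset orb_rep_in_orb by blast

lemma orb_rep_image_subset: "x \<in> orb_rep ` E \<Longrightarrow> x \<in> E"
  by (elim imageE) (simp add: orb_rep_closed)

lemma orb_orb_rep: "u \<in> E \<Longrightarrow> orb (orb_rep u) = orb u"
  using orb_eq orb_rep_in_orb by blast

lemma orb_rep_eq: "orb u = orb v \<Longrightarrow> orb_rep u = orb_rep v"
  unfolding orb_rep_def by simp

lemma orb_dist_cong: "\<lbrakk>orb u = orb u'; orb v = orb v'\<rbrakk> \<Longrightarrow> orb_dist u v = orb_dist u' v'"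
  unfolding orb_dist_def by simp

lemma orb_dist_orb_rep: "\<lbrakk>u \<in> E; v \<in> E\<rbrakk> \<Longrightarrow> orb_dist (orb_rep u) (orb_rep v) = orb_dist u v"
  by (intro orb_dist_cong orb_orb_rep)

lemma orb_dist_le: "\<lbrakk>a \<in> orb u; b \<in> orb v\<rbrakk> \<Longrightarrow> orb_dist u v \<le> \<rho> a b"
  unfolding orb_dist_def using finite_orb by (intro Min_le) auto

lemma orb_dist_attained: obtains a b where "a \<in> orb u" "b \<in> orb v" "orb_dist u v = \<rho> a b"
proof -
  have "orb u \<times> orb v \<noteq> {}" using orb_self by blast
  hence "orb_dist u v \<in> (\<lambda>(a, b). \<rho> a b) ` (orb u \<times> orb v)"
    unfolding orb_dist_def using finite_orb by (intro Min_in) simp_all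
  then obtain c where "c \<in> orb u \<times> orb v" "orb_dist u v = (case c of (a, b) \<Rightarrow> \<rho> a b)" by blast
  thus ?thesis using that[of "fst c" "snd c"] by (simp add: case_prod_beta mem_Times_iff)
qed

lemma orb_dist_nonneg: "0 \<le> orb_dist u v"
  by (rule orb_dist_attained[of u v]) simp

text \<open>
  The isometries move any minimising pair so that it starts at a prescribed point of the first
  orbit. All geometric properties of the quotient come from lifting distances in this way.
\<close>

lemma orb_dist_lift:
  assumes u: "u \<in> E" and v: "v \<in> E" and a: "a \<in> orb u"
  shows "\<exists>b\<in>orb v. \<rho> a b = orb_dist u v"
proof -
  obtain a' b' where ab: "a' \<in> orb u" "b' \<in> orb v" "orb_dist u v = \<rho> a' b'"
    by (rule orb_dist_attained)
  have "a \<in> orb a'" using orb_eq[OF u ab(1)] a by simp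
  then obtain g where g: "g \<in> G" "a = g a'" unfolding orb_def by blast
  have "g b' \<in> orb v" using g orb_eq[OF v ab(2)] unfolding orb_def by blast
  moreover have "\<rho> a (g b') = orb_dist u v"
    using isometry[OF g(1) orb_subset[OF u ab(1)] orb_subset[OF v ab(2)]] ab(3) g(2) by simp
  ultimately show ?thesis by blast
qed

lemma Metric_space_quotient: "Metric_space (orb_rep ` E) orb_dist"
proof
  fix x y z
  show "0 \<le> orb_dist x y" by (rule orb_dist_nonneg)
  show "orb_dist x y = orb_dist y x"
  proof -
    have "orb_dist p q \<le> orb_dist q p" for p q
    proof -
      obtain a b where "a \<in> orb q" "b \<in> orb p" "orb_dist q p = \<rho> a b" by (rule orb_dist_attained)
      thus ?thesis using orb_dist_le[of b p a q] commute[of a b] by simp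
    qed
    thus ?thesis by (simp add: antisym)
  qed
  show "orb_dist x y = 0 \<longleftrightarrow> x = y" if xy: "x \<in> orb_rep ` E" "y \<in> orb_rep ` E"
  proof
    assume D0: "orb_dist x y = 0"
    obtain p q where pq: "p \<in> E" "q \<in> E" "x = orb_rep p" "y = orb_rep q" using xy by blast
    then obtain b where b: "b \<in> orb q" "\<rho> p b = orb_dist p q" using orb_dist_lift[OF _ _ orb_self] by blast
    have "\<rho> p b = 0" using D0 orb_dist_orb_rep pq b by simp
    hence "p = b" using zero orb_subset pq b by blast
    thus "x = y" using pq b orb_eq orb_rep_eq by metis
  next
    assume "x = y"
    have "x \<in> E" using xy by (simp_all add: orb_rep_image_subset)
    hence "orb_dist x x \<le> 0" using orb_dist_le[OF orb_self orb_self, of x x] by simp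
    moreover have "0 \<le> orb_dist x x" by (rule orb_dist_nonneg)
    ultimately show "orb_dist x y = 0" using \<open>x = y\<close> by simp
  qed
  show "orb_dist x z \<le> orb_dist x y + orb_dist y z" if "x \<in> orb_rep ` E" "y \<in> orb_rep ` E" "z \<in> orb_rep ` E"
  proof -
    have E: "x \<in> E" "y \<in> E" "z \<in> E" using that by (simp_all add: orb_rep_image_subset)
    obtain b where b: "b \<in> orb y" "\<rho> x b = orb_dist x y" using orb_dist_lift[OF E(1,2) orb_self] by blast
    obtain c where c: "c \<in> orb z" "\<rho> b c = orb_dist y z" using orb_dist_lift[OF E(2,3) b(1)] by blast
    have "orb_dist x z \<le> \<rho> x c" using orb_dist_le orb_self c(1) by blast
    also have "\<dots> \<le> \<rho> x b + \<rho> b c" using E b c orb_subset by (intro triangle) blast+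
    finally show ?thesis using b c by simp
  qed
qed

sublocale Q: Metric_space "orb_rep ` E" orb_dist
  by (rule Metric_space_quotient)

text \<open>
  A Cauchy sequence of orbits has a subsequence whose steps are summable. Lifting the steps one after
  the other gives a Cauchy sequence upstairs, and the orbit of its limit is the limit of the orbits.
\<close>

lemma mcomplete_quotient:
  assumes compl: "mcomplete"
  shows "Q.mcomplete"
  unfolding Q.mcomplete_def
proof (intro allI impI)
  fix \<sigma> assume \<sigma>: "Q.MCauchy \<sigma>"
  have \<sigma>M: "\<sigma> n \<in> orb_rep ` E" for n using \<sigma> unfolding Q.MCauchy_def by blast
  have \<sigma>E: "\<sigma> n \<in> E" for n using \<sigma>M[of n] by (rule orb_rep_image_subset)
  have tail: "\<exists>N. \<forall>n\<ge>N. \<forall>n'\<ge>N. orb_dist (\<sigma> n) (\<sigma> n') < (1/2)^k" for k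
  proof -
    have "(0::real) < (1/2)^k" by simp
    moreover have "\<forall>\<epsilon>>0. \<exists>N. \<forall>n n'. N \<le> n \<longrightarrow> N \<le> n' \<longrightarrow> orb_dist (\<sigma> n) (\<sigma> n') < \<epsilon>"
      using \<sigma> unfolding Q.MCauchy_def by (rule conjunct2)
    ultimately obtain N where "\<forall>n n'. N \<le> n \<longrightarrow> N \<le> n' \<longrightarrow> orb_dist (\<sigma> n) (\<sigma> n') < (1/2)^k"
      by (elim allE impE) auto
    thus ?thesis by auto
  qed
  have "\<exists>N. \<forall>k. \<forall>n\<ge>N k. \<forall>n'\<ge>N k. orb_dist (\<sigma> n) (\<sigma> n') < (1/2)^k"
    by (intro choice allI tail)
  then obtain N where N: "\<And>k n n'. \<lbrakk>n \<ge> N k; n' \<ge> N k\<rbrakk> \<Longrightarrow> orb_dist (\<sigma> n) (\<sigma> n') < (1/2)^k"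
    by blast
  \<comment> \<open>A state is a position in the sequence together with a lift of the orbit at that position.\<close>
  define P where "P k s \<longleftrightarrow> fst s \<ge> N k \<and> snd s \<in> orb (\<sigma> (fst s))" for k and s :: "nat \<times> 'a"
  define R where "R k s s' \<longleftrightarrow> fst s < fst s' \<and> \<rho> (snd s) (snd s') < (1/2)^k" for k :: nat and s s' :: "nat \<times> 'a"
  have "\<exists>s'. P (Suc k) s' \<and> R k s s'" if "P k s" for k s
  proof -
    have sP: "snd s \<in> orb (\<sigma> (fst s))" using that unfolding P_def by (rule conjunct2)
    define m where "m = max (Suc (fst s)) (N (Suc k))"
    have m: "fst s < m" "m \<ge> N (Suc k)" by (auto simp: m_def)
    obtain b where "b \<in> orb (\<sigma> m)" "\<rho> (snd s) b = orb_dist (\<sigma> (fst s)) (\<sigma> m)"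
      using orb_dist_lift[OF \<sigma>E \<sigma>E sP, of m] by blast
    moreover have "orb_dist (\<sigma> (fst s)) (\<sigma> m) < (1/2)^k" using that m(1) N[of k] unfolding P_def by simp
    ultimately show ?thesis using m by (intro exI[of _ "(m, b)"]) (simp add: P_def R_def)
  qed
  moreover have "\<exists>s. P 0 s" using orb_self by (auto simp: P_def)
  ultimately obtain f where f: "\<And>k. P k (f k)" "\<And>k. R k (f k) (f (Suc k))"
    using dependent_nat_choice[of P R] by metis
  define r where "r k = fst (f k)" for k
  define v where "v k = snd (f k)" for k
  have r: "strict_mono r"
    using f(2) unfolding strict_mono_Suc_iff r_def R_def by blast
  have v: "v k \<in> orb (\<sigma> (r k))" for k using f(1)[of k] by (simp add: P_def r_def v_def)
  have vE: "v k \<in> E" for k using v orb_subset \<sigma>E by blast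
  have step: "\<rho> (v k) (v (Suc k)) < (1/2)^k" for k
    using f(2)[of k] by (simp add: R_def v_def)
  have far: "\<rho> (v k) (v (k + n)) \<le> 2 * (1/2)^k - 2 * (1/2)^(k+n)" for k n
  proof (induction n)
    case 0
    thus ?case using vE by simp
  next
    case (Suc n)
    have "\<rho> (v k) (v (k + Suc n)) \<le> \<rho> (v k) (v (k + n)) + \<rho> (v (k + n)) (v (k + Suc n))"
      using vE by (intro triangle)
    thus ?case using Suc step[of "k + n"] by simp
  qed
  have "MCauchy v"
    unfolding MCauchy_def
  proof (intro conjI allI impI)
    show "range v \<subseteq> E" using vE by blast
    fix \<epsilon> :: real assume "\<epsilon> > 0"
    then obtain K where K: "(1/2::real)^K < \<epsilon> / 4"
      using real_arch_pow_inv[of "\<epsilon>/4" "1/2"] by auto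
    have b: "\<rho> (v K) (v n) < \<epsilon> / 2" if "K \<le> n" for n
    proof -
      have "\<rho> (v K) (v n) \<le> 2 * (1/2)^K - 2 * (1/2)^n" using far[of K "n - K"] that by simp
      moreover have "0 \<le> (1/2::real)^n" by simp
      ultimately show ?thesis using K by linarith
    qed
    have "\<rho> (v n) (v n') < \<epsilon>" if "K \<le> n" "K \<le> n'" for n n'
      using triangle[OF vE[of n] vE[of K] vE[of n']] commute[of "v n" "v K"] b[OF that(1)] b[OF that(2)]
      by linarith
    thus "\<exists>N. \<forall>n n'. N \<le> n \<longrightarrow> N \<le> n' \<longrightarrow> \<rho> (v n) (v n') < \<epsilon>" by blast
  qed
  then obtain l where l: "l \<in> E" "\<And>\<epsilon>. \<epsilon> > 0 \<Longrightarrow> \<exists>N. \<forall>n\<ge>N. \<rho> (v n) l < \<epsilon>"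
    using compl unfolding mcomplete_def limit_metric_sequentially by meson
  have close: "orb_dist ((\<sigma> \<circ> r) n) (orb_rep l) \<le> \<rho> (v n) l" for n
    using orb_dist_le[OF v[of n], of l "orb_rep l"] orb_orb_rep[OF l(1)] orb_self by simp
  have "limitin Q.mtopology (\<sigma> \<circ> r) (orb_rep l) sequentially"
    unfolding Q.limit_metric_sequentially
  proof (intro conjI allI impI)
    show "orb_rep l \<in> orb_rep ` E" using l(1) by blast
    fix \<epsilon> :: real assume "\<epsilon> > 0"
    then obtain N where "\<forall>n\<ge>N. \<rho> (v n) l < \<epsilon>" using l(2) by blast
    hence "\<forall>n\<ge>N. (\<sigma> \<circ> r) n \<in> orb_rep ` E \<and> orb_dist ((\<sigma> \<circ> r) n) (orb_rep l) < \<epsilon>"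
      using close \<sigma>M by (auto intro: le_less_trans)
    thus "\<exists>N. \<forall>n\<ge>N. (\<sigma> \<circ> r) n \<in> orb_rep ` E \<and> orb_dist ((\<sigma> \<circ> r) n) (orb_rep l) < \<epsilon>" ..
  qed
  thus "\<exists>x. limitin Q.mtopology \<sigma> x sequentially"
    using Q.MCauchy_convergent_subsequence[OF \<sigma> r] by blast
qed

text \<open>
  A geodesic between two points that realise the distance of their orbits projects to a
  1-Lipschitz curve; its total length leaves no room for a strict inequality on any subinterval.
\<close>

lemma geodesic_quotient:
  assumes geo: "geodesic_metric_space E \<rho>"
  shows "geodesic_metric_space (orb_rep ` E) orb_dist"
  unfolding geodesic_metric_space_def
proof (intro conjI ballI)
  show "Metric_space (orb_rep ` E) orb_dist" by (rule Metric_space_quotient)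
  fix x y assume xy: "x \<in> orb_rep ` E" "y \<in> orb_rep ` E"
  have E: "x \<in> E" "y \<in> E" using xy by (simp_all add: orb_rep_image_subset)
  obtain b where b: "b \<in> orb y" "\<rho> x b = orb_dist x y" using orb_dist_lift[OF E(1,2) orb_self] by blast
  have bE: "b \<in> E" using b E orb_subset by blast
  define L where "L = orb_dist x y"
  have "\<exists>g. g ` {0..\<rho> x b} \<subseteq> E \<and> g 0 = x \<and> g (\<rho> x b) = b \<and>
      (\<forall>s\<in>{0..\<rho> x b}. \<forall>t\<in>{0..\<rho> x b}. \<rho> (g s) (g t) = \<bar>s - t\<bar>)"
    using geo E(1) bE unfolding geodesic_metric_space_def by blast
  then obtain g where g': "g ` {0..L} \<subseteq> E \<and> g 0 = x \<and> g L = b \<and>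
      (\<forall>s\<in>{0..L}. \<forall>t\<in>{0..L}. \<rho> (g s) (g t) = \<bar>s - t\<bar>)"
    unfolding b(2) L_def by (rule exE)
  have g: "g ` {0..L} \<subseteq> E" "g 0 = x" "g L = b"
    using g' by simp_all
  have g_dist: "\<rho> (g s) (g t) = \<bar>s - t\<bar>" if "s \<in> {0..L}" "t \<in> {0..L}" for s t
    using g' that by blast
  have gE: "g s \<in> E" if "s \<in> {0..L}" for s using g(1) that by blast
  have rep_fix: "orb_rep z = z" if "z \<in> orb_rep ` E" for z
    using that by (elim imageE) (simp add: orb_rep_eq[OF orb_orb_rep])
  have le: "orb_dist (orb_rep (g s)) (orb_rep (g t)) \<le> \<bar>s - t\<bar>" if "s \<in> {0..L}" "t \<in> {0..L}" for s t
    using orb_dist_le[OF orb_self orb_self, of "g s" "g t"] orb_dist_orb_rep[OF gE gE, OF that] g_dist[OF that] by simp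
  have end0: "orb_rep (g 0) = x" using g(2) rep_fix[OF xy(1)] by simp
  have end1: "orb_rep (g L) = y" using g(3) orb_rep_eq[OF orb_eq[OF E(2) b(1)]] rep_fix[OF xy(2)] by simp
  have L0: "L \<ge> 0" unfolding L_def by simp
  have ge: "t - s \<le> orb_dist (orb_rep (g s)) (orb_rep (g t))" if "s \<in> {0..L}" "t \<in> {0..L}" "s \<le> t" for s t
  proof -
    have M: "orb_rep (g s) \<in> orb_rep ` E" "orb_rep (g t) \<in> orb_rep ` E" using gE that by blast+
    have "L \<le> orb_dist x (orb_rep (g s)) + orb_dist (orb_rep (g s)) (orb_rep (g t)) + orb_dist (orb_rep (g t)) y"
      using Q.triangle[OF xy(1) M(1) xy(2)] Q.triangle[OF M(1) M(2) xy(2)] unfolding L_def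
      by linarith
    moreover have "orb_dist x (orb_rep (g s)) \<le> s" using le[of 0 s] end0 that L0 by simp
    moreover have "orb_dist (orb_rep (g t)) y \<le> L - t" using le[of t L] end1 that L0 by simp
    ultimately show ?thesis by linarith
  qed
  have eq: "orb_dist (orb_rep (g s)) (orb_rep (g t)) = \<bar>s - t\<bar>" if st: "s \<in> {0..L}" "t \<in> {0..L}" for s t
  proof (cases "s \<le> t")
    case True
    thus ?thesis using ge[OF st] le[OF st] by linarith
  next
    case False
    hence "t \<le> s" by simp
    thus ?thesis using ge[OF st(2,1)] le[OF st] Q.commute[of "orb_rep (g s)" "orb_rep (g t)"] by linarith
  qed
  show "\<exists>h. h ` {0..orb_dist x y} \<subseteq> orb_rep ` E \<and> h 0 = x \<and> h (orb_dist x y) = y \<and>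
      (\<forall>s\<in>{0..orb_dist x y}. \<forall>t\<in>{0..orb_dist x y}. orb_dist (h s) (h t) = \<bar>s - t\<bar>)"
    using gE end0 end1 eq by (intro exI[of _ "\<lambda>t. orb_rep (g t)"]) (auto simp: L_def)
qed

text \<open>
  Lift the midpoint \<open>w\<close> to itself and the other three points to the points of their
  orbits closest to it. The lifts of the two ends are then at most \<open>d(x,y)/2 + d(x,y)/2\<close>
  apart, hence exactly \<open>d(x,y)\<close>, so \<open>w\<close> is a midpoint upstairs. The inequality
  upstairs descends, because passing to orbits keeps \<open>d(x,y)\<close> and \<open>d(z,w)\<close> and
  does not increase \<open>d(x,z)\<close> and \<open>d(y,z)\<close>.
\<close>

theorem alexandrov_quotient:
  assumes alex: "alexandrov_nonneg_curved E \<rho>"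
  shows "alexandrov_nonneg_curved (orb_rep ` E) orb_dist"
  unfolding alexandrov_nonneg_curved_def
proof (intro conjI ballI impI)
  fix x y z w
  assume M: "x \<in> orb_rep ` E" "y \<in> orb_rep ` E" "z \<in> orb_rep ` E" "w \<in> orb_rep ` E"
    and mid: "metric_midpoint orb_dist x y w"
  have E: "x \<in> E" "y \<in> E" "z \<in> E" "w \<in> E" using M by (simp_all add: orb_rep_image_subset)
  obtain a where a: "a \<in> orb x" "\<rho> w a = orb_dist w x" using orb_dist_lift[OF E(4,1) orb_self] by blast
  obtain b where b: "b \<in> orb y" "\<rho> w b = orb_dist w y" using orb_dist_lift[OF E(4,2) orb_self] by blast
  obtain c where c: "c \<in> orb z" "\<rho> w c = orb_dist w z" using orb_dist_lift[OF E(4,3) orb_self] by blast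
  have abc: "a \<in> E" "b \<in> E" "c \<in> E" using a b c E orb_subset by blast+
  have wx: "orb_dist w x = orb_dist x y / 2" "orb_dist w y = orb_dist x y / 2"
    using mid Q.commute unfolding metric_midpoint_def by metis+
  have "\<rho> a b \<le> \<rho> a w + \<rho> w b" using abc E by (intro triangle)
  also have "\<dots> = orb_dist x y" using a b wx commute[of a w] by simp
  finally have ab: "\<rho> a b = orb_dist x y" using orb_dist_le[OF a(1) b(1)] by linarith
  have "metric_midpoint \<rho> a b w"
    unfolding metric_midpoint_def using ab a b wx commute by metis
  hence "2 * (\<rho> a c)\<^sup>2 + 2 * (\<rho> b c)\<^sup>2 \<le> (\<rho> a b)\<^sup>2 + 4 * (\<rho> c w)\<^sup>2"
    using alex abc E(4) unfolding alexandrov_nonneg_curved_def by blast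
  moreover have "(orb_dist x z)\<^sup>2 \<le> (\<rho> a c)\<^sup>2" "(orb_dist y z)\<^sup>2 \<le> (\<rho> b c)\<^sup>2"
    using orb_dist_le a(1) b(1) c(1) by (auto intro!: power_mono)
  ultimately show "2 * (orb_dist x z)\<^sup>2 + 2 * (orb_dist y z)\<^sup>2 \<le> (orb_dist x y)\<^sup>2 + 4 * (orb_dist z w)\<^sup>2"
    unfolding ab commute[of c w] c(2) Q.commute[of z w] by linarith
qed (use alex Metric_space_quotient mcomplete_quotient geodesic_quotient in
      \<open>auto simp: alexandrov_nonneg_curved_def\<close>)

end


section \<open>Configurations of indistinguishable particles\<close>

definition sqdist :: "'c set \<Rightarrow> ('c \<Rightarrow> real) \<Rightarrow> ('c \<Rightarrow> real) \<Rightarrow> real" where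
  "sqdist C a b = (\<Sum>k\<in>C. (a k - b k)\<^sup>2)"

lemma sqdist_self[simp]: "sqdist C a a = 0"
  by (simp add: sqdist_def)

text \<open>
  A finite family of points \<open>f v\<close> of \<open>\<real>\<^sup>C\<close>, the background, is
  kept fixed, and one further point \<open>z\<close> is added to it. The particles are labelled by
  \<open>V\<close> and \<open>None\<close>; forgetting the labels means dividing the Euclidean space of
  all labelled configurations by the permutations of the labels. The quotient distance is, up to
  normalisation, the quadratic Wasserstein distance of the associated counting measures.
\<close>

locale background =
  fixes V :: "'v::countable set" and C :: "'c::countable set" and f :: "'v \<Rightarrow> 'c \<Rightarrow> real"
  assumes finV: "finite V" and finC: "finite C"
begin

definition W :: "'v option set" where "W = insert None (Some ` V)"

definition config :: "('c \<Rightarrow> real) \<Rightarrow> 'v option \<times> 'c \<Rightarrow> real" where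
  "config z = (\<lambda>(w, k). if w \<in> W \<and> k \<in> C then (case w of None \<Rightarrow> z | Some v \<Rightarrow> f v) k else 0)"

definition relabel :: "('v option \<Rightarrow> 'v option) \<Rightarrow> ('v option \<times> 'c \<Rightarrow> real) \<Rightarrow> 'v option \<times> 'c \<Rightarrow> real" where
  "relabel p u = (\<lambda>(w, k). u (p w, k))"

abbreviation "relabellings \<equiv> relabel ` {p. p permutes W}"

lemma finW: "finite W"
  using finV by (simp add: W_def)

lemma euclid_dist_config_space:
  "euclid_dist (W \<times> C) u v = sqrt (\<Sum>w\<in>W. \<Sum>k\<in>C. (u (w, k) - v (w, k))\<^sup>2)"
  by (simp add: euclid_dist_def L2_set_def sum.cartesian_product case_prod_unfold)

sublocale conf: finite_isometry_action "euclid (W \<times> C)" "euclid_dist (W \<times> C)" relabellings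
proof -
  interpret Metric_space "euclid (W \<times> C)" "euclid_dist (W \<times> C)"
    using finW finC by (intro Metric_space_euclid) simp
  show "finite_isometry_action (euclid (W \<times> C)) (euclid_dist (W \<times> C)) relabellings"
  proof
    show "finite relabellings" using finW finite_permutations by blast
    have "relabel id = id" by (simp add: relabel_def fun_eq_iff)
    thus "id \<in> relabellings" using permutes_id[of W] by (metis image_eqI mem_Collect_eq)
  next
    fix g x assume "g \<in> relabellings" "x \<in> euclid (W \<times> C)"
    thus "g x \<in> euclid (W \<times> C)"
      by (auto simp: relabel_def euclid_def permutes_in_image)
  next
    fix g h assume "g \<in> relabellings" "h \<in> relabellings"
    then obtain p q where pq: "p permutes W" "q permutes W" "g = relabel p" "h = relabel q" by auto
    have "q \<circ> p permutes W" using pq by (simp add: permutes_compose)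
    moreover have "relabel (q \<circ> p) x = g (h x)" for x
      by (simp add: relabel_def pq fun_eq_iff)
    ultimately show "\<exists>k\<in>relabellings. \<forall>x\<in>euclid (W \<times> C). k x = g (h x)" by blast
  next
    fix g assume "g \<in> relabellings"
    then obtain p where p: "p permutes W" "g = relabel p" by auto
    have "inv p permutes W" using p(1) by (rule permutes_inv)
    moreover have "relabel (inv p) (g x) = x" for x
      using permutes_inverses[OF p(1)] by (simp add: relabel_def p(2) fun_eq_iff)
    ultimately show "\<exists>k\<in>relabellings. \<forall>x\<in>euclid (W \<times> C). k (g x) = x" by blast
  next
    fix g x y assume "g \<in> relabellings"
    then obtain p where p: "p permutes W" "g = relabel p" by auto
    show "euclid_dist (W \<times> C) (g x) (g y) = euclid_dist (W \<times> C) x y"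
      unfolding euclid_dist_config_space
      using sum.permute[OF p(1), of "\<lambda>w. \<Sum>k\<in>C. (x (w, k) - y (w, k))\<^sup>2"]
      by (simp add: p(2) relabel_def o_def)
  qed
qed

text \<open>
  The index of the point occupied by the particle with label \<open>w\<close> when the additional particle
  sits at \<open>f u\<close>.
\<close>

definition site :: "'v \<Rightarrow> 'v option \<Rightarrow> 'v" where
  "site u w = (case w of None \<Rightarrow> u | Some v \<Rightarrow> v)"

lemma site_simps[simp]: "site u None = u" "site u (Some v) = v"
  by (simp_all add: site_def)

definition cost :: "('v option \<Rightarrow> 'v option) \<Rightarrow> 'v \<Rightarrow> 'v \<Rightarrow> real" where
  "cost p u v = (\<Sum>w\<in>W. sqdist C (f (site u w)) (f (site v (p w))))"

lemma config_euclid: "config z \<in> euclid (W \<times> C)"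
  by (auto simp: config_def euclid_def)

lemma euclid_dist_config:
  assumes "p permutes W"
  shows "(euclid_dist (W \<times> C) (config (f u)) (relabel p (config (f v))))\<^sup>2 = cost p u v"
proof -
  have "(euclid_dist (W \<times> C) (config (f u)) (relabel p (config (f v))))\<^sup>2
      = (\<Sum>w\<in>W. \<Sum>k\<in>C. (config (f u) (w, k) - config (f v) (p w, k))\<^sup>2)"
    unfolding euclid_dist_config_space relabel_def by (simp add: sum_nonneg)
  also have "\<dots> = cost p u v"
    unfolding cost_def sqdist_def
    by (intro sum.cong refl)
      (simp add: config_def permutes_in_image[OF assms] site_def split: option.split)
  finally show ?thesis .
qed

lemma config_dist_le: "p permutes W \<Longrightarrow> (conf.orb_dist (config (f u)) (config (f v)))\<^sup>2 \<le> cost p u v"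
proof -
  assume p: "p permutes W"
  have "relabel p (config (f v)) \<in> conf.orb (config (f v))"
    unfolding conf.orb_def using p by blast
  hence "conf.orb_dist (config (f u)) (config (f v)) \<le> euclid_dist (W \<times> C) (config (f u)) (relabel p (config (f v)))"
    by (intro conf.orb_dist_le conf.orb_self)
  thus ?thesis using euclid_dist_config[OF p] conf.orb_dist_nonneg by (metis power_mono)
qed

lemma config_dist_attained:
  obtains p where "p permutes W" "(conf.orb_dist (config (f u)) (config (f v)))\<^sup>2 = cost p u v"
proof -
  obtain b where b: "b \<in> conf.orb (config (f v))"
      "euclid_dist (W \<times> C) (config (f u)) b = conf.orb_dist (config (f u)) (config (f v))"
    using conf.orb_dist_lift[OF config_euclid config_euclid conf.orb_self] by blast
  from b(1) obtain p where p: "p permutes W" "b = relabel p (config (f v))"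
    unfolding conf.orb_def by auto
  show ?thesis
    using that[OF p(1)] euclid_dist_config[OF p(1), of u v] b(2) unfolding p(2) by simp
qed

text \<open>
  The easy half of Kantorovich duality. Every matching moves the background and \<open>u\<close> to the
  background and \<open>v\<close>, so the contributions of the background to the total change of
  \<open>\<phi>\<close> cancel and \<open>\<phi> u - \<phi> v\<close> remains.
\<close>

lemma potential_le_config_dist:
  assumes uv: "u \<in> V" "v \<in> V"
    and \<phi>: "\<And>a b. \<lbrakk>a \<in> V; b \<in> V\<rbrakk> \<Longrightarrow> \<phi> a - \<phi> b \<le> sqdist C (f a) (f b)"
  shows "\<phi> u - \<phi> v \<le> (conf.orb_dist (config (f u)) (config (f v)))\<^sup>2"
proof -
  obtain p where p: "p permutes W" "(conf.orb_dist (config (f u)) (config (f v)))\<^sup>2 = cost p u v"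
    by (rule config_dist_attained)
  have siteV: "site a w \<in> V" if "a \<in> V" "w \<in> W" for a w
    using that by (auto simp: W_def)
  have "(\<Sum>w\<in>W. \<phi> (site v (p w))) = (\<Sum>w\<in>W. \<phi> (site v w))"
    using sum.permute[OF p(1), of "\<lambda>w. \<phi> (site v w)"] by (simp add: o_def)
  moreover have "(\<Sum>w\<in>W. \<phi> (site a w)) = \<phi> a + (\<Sum>w\<in>Some ` V. \<phi> (the w))" for a
  proof -
    have "(\<Sum>w\<in>Some ` V. \<phi> (site a w)) = (\<Sum>w\<in>Some ` V. \<phi> (the w))"
      by (intro sum.cong) auto
    thus ?thesis unfolding W_def using finV by simp
  qed
  ultimately have "\<phi> u - \<phi> v = (\<Sum>w\<in>W. \<phi> (site u w) - \<phi> (site v (p w)))"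
    by (simp add: sum_subtractf)
  also have "\<dots> \<le> cost p u v"
    unfolding cost_def using uv p(1) siteV by (intro sum_mono \<phi>) (simp_all add: permutes_in_image)
  finally show ?thesis using p(2) by simp
qed

text \<open>
  The extra particle need not travel itself: it pushes the first background point of the chain one step
  forward, which pushes the next one, and so on. Squared distances add up along the chain, which
  is how this distance manages to be small compared to the square of the distance of the ends.
  The induction removes the first link; the label of the point \<open>b\<close> reached by it has to be
  still unused, which is why the claim records that labels off the chain stay fixed.
\<close>

lemma chain_matching:
  assumes "inj_on c {..K}" "c ` {..K} \<subseteq> V"
  shows "\<exists>p. p permutes W \<and> (\<forall>a. a \<notin> c ` {1..K} \<longrightarrow> p (Some a) = Some a) \<and>
      cost p (c 0) (c K) = (\<Sum>k<K. sqdist C (f (c k)) (f (c (Suc k))))"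
  using assms
proof (induction K arbitrary: c)
  case 0
  show ?case by (intro exI[of _ id] conjI permutes_id) (simp_all add: cost_def)
next
  case (Suc K)
  define b where "b = c 1"
  have "inj_on (c \<circ> Suc) {..K}"
    using Suc.prems(1) by (auto simp: inj_on_def)
  moreover have "(c \<circ> Suc) ` {..K} \<subseteq> V" using Suc.prems(2) by auto
  ultimately obtain q where IH: "q permutes W \<and>
      (\<forall>a. a \<notin> (c \<circ> Suc) ` {1..K} \<longrightarrow> q (Some a) = Some a) \<and>
      cost q ((c \<circ> Suc) 0) ((c \<circ> Suc) K)
        = (\<Sum>k<K. sqdist C (f ((c \<circ> Suc) k)) (f ((c \<circ> Suc) (Suc k))))"
    using Suc.IH[of "c \<circ> Suc"] by blast
  have q: "q permutes W"
      "\<And>a. a \<notin> (c \<circ> Suc) ` {1..K} \<Longrightarrow> q (Some a) = Some a"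
      "cost q b (c (Suc K)) = (\<Sum>k<K. sqdist C (f (c (Suc k))) (f (c (Suc (Suc k)))))"
    using IH by (blast, blast, simp add: b_def)
  have "b \<notin> (c \<circ> Suc) ` {1..K}"
  proof
    assume "b \<in> (c \<circ> Suc) ` {1..K}"
    then obtain x where "1 \<le> x" "x \<le> K" "c 1 = c (Suc x)" by (auto simp: b_def)
    thus False using inj_onD[OF Suc.prems(1), of 1 "Suc x"] by simp
  qed
  hence qb: "q (Some b) = Some b" by (rule q(2))
  have bV: "b \<in> V" using Suc.prems(2) by (auto simp: b_def)
  hence bW: "Some b \<in> W" "None \<in> W" by (auto simp: W_def)
  \<comment> \<open>\<open>None\<close> now takes the place of \<open>b\<close>, and \<open>Some b\<close> plays the role that
    \<open>None\<close> has in \<open>q\<close>.\<close>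
  define p where "p = q \<circ> Transposition.transpose None (Some b)"
  have p: "p permutes W"
    unfolding p_def using q(1) bW by (intro permutes_compose permutes_swap_id)
  have "p (Some a) = Some a" if "a \<notin> c ` {1..Suc K}" for a
  proof -
    have "a \<noteq> b" using that by (auto simp: b_def)
    moreover have "a \<notin> (c \<circ> Suc) ` {1..K}" using that by auto
    ultimately show ?thesis using q(2) by (simp add: p_def)
  qed
  moreover have "cost p (c 0) (c (Suc K)) = sqdist C (f (c 0)) (f b) + cost q b (c (Suc K))"
  proof -
    define R where "R = W - {None, Some b}"
    have WR: "W = insert None (insert (Some b) R)" and R: "finite R" "None \<notin> R" "Some b \<notin> R"
      using bW finW by (auto simp: R_def)
    have "(\<Sum>w\<in>R. sqdist C (f (site (c 0) w)) (f (site (c (Suc K)) (p w))))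
        = (\<Sum>w\<in>R. sqdist C (f (site b w)) (f (site (c (Suc K)) (q w))))"
    proof (intro sum.cong refl)
      fix w assume "w \<in> R"
      then obtain a where "w = Some a" "a \<noteq> b" by (cases w) (auto simp: R_def)
      thus "sqdist C (f (site (c 0) w)) (f (site (c (Suc K)) (p w)))
          = sqdist C (f (site b w)) (f (site (c (Suc K)) (q w)))"
        by (simp add: p_def)
    qed
    thus ?thesis
      unfolding cost_def WR using R by (simp add: p_def qb)
  qed
  ultimately show ?case
    using p q(3) by (intro exI[of _ p]) (simp only: sum.lessThan_Suc_shift b_def One_nat_def, simp)
qed

lemma config_dist_le_chain:
  assumes "inj_on c {..K}" "c ` {..K} \<subseteq> V"
  shows "(conf.orb_dist (config (f (c 0))) (config (f (c K))))\<^sup>2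
      \<le> (\<Sum>k<K. sqdist C (f (c k)) (f (c (Suc k))))"
proof -
  obtain p where "p permutes W" "cost p (c 0) (c K) = (\<Sum>k<K. sqdist C (f (c k)) (f (c (Suc k))))"
    using chain_matching[OF assms] by (elim exE conjE)
  thus ?thesis using config_dist_le[of p "c 0" "c K"] by simp
qed

lemma quadratic_inequality_config:
  assumes AB: "alexandrov_quadratic_inequality A B"
  shows "(\<Sum>i\<in>UNIV. \<Sum>j\<in>UNIV. A $ i $ j * (conf.orb_dist (config (f (x i))) (config (f (x j))))\<^sup>2)
      \<le> (\<Sum>i\<in>UNIV. \<Sum>j\<in>UNIV. B $ i $ j * (conf.orb_dist (config (f (x i))) (config (f (x j))))\<^sup>2)"
proof -
  have fin: "finite (W \<times> C)" using finW finC by simp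
  have "quadratic_metric_inequality A B (conf.orb_rep ` euclid (W \<times> C)) conf.orb_dist"
    by (intro alexandrov_quadratic_inequality_fun_spaces[OF AB] conf.alexandrov_quotient
        alexandrov_euclid fin)
  moreover have "range (\<lambda>i. conf.orb_rep (config (f (x i)))) \<subseteq> conf.orb_rep ` euclid (W \<times> C)"
    using config_euclid by blast
  ultimately show ?thesis
    unfolding quadratic_metric_inequality_def
    by (elim allE[of _ "\<lambda>i. conf.orb_rep (config (f (x i)))"] impE)
      (simp_all only: conf.orb_dist_orb_rep[OF config_euclid config_euclid])
qed

end


section \<open>A network of chains without shortcuts\<close>

lemma sum_indicator_diff_sq:
  assumes "finite T" "S \<subseteq> T" "S' \<subseteq> T"
  shows "(\<Sum>t\<in>T. (indicator S t - indicator S' t)\<^sup>2 :: real) = card (S - S' \<union> (S' - S))"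
proof -
  have "(\<Sum>t\<in>T. (indicator S t - indicator S' t)\<^sup>2 :: real) = (\<Sum>t\<in>T. if t \<in> S - S' \<union> (S' - S) then 1 else 0)"
    by (intro sum.cong refl) (auto simp: indicator_def)
  also have "\<dots> = card (T \<inter> (S - S' \<union> (S' - S)))"
    using assms(1) by (simp add: sum.If_cases del: Un_iff Diff_iff)
  also have "T \<inter> (S - S' \<union> (S' - S)) = S - S' \<union> (S' - S)" using assms by blast
  finally show ?thesis .
qed

text \<open>
  Let \<open>m\<close> be a metric with integer values on finitely many nodes. Any two nodes \<open>i\<close> and
  \<open>j\<close> are joined by a path of \<open>2 * m i j\<close> short steps through the beads
  \<open>(i, j, p)\<close>, \<open>p \<le> 2 * m i j\<close>, in such a way that the distances of two beads from any node, measured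
  along the network, differ by at most the squared Euclidean distance of the beads. The numbering \<open>to_nat\<close> only serves
  to use each unordered pair once.
\<close>

locale network =
  fixes m :: "'n::finite \<Rightarrow> 'n \<Rightarrow> nat" and Mx :: nat
  assumes m_self [simp]: "m i i = 0"
    and m_pos: "i \<noteq> j \<Longrightarrow> 0 < m i j"
    and m_sym: "m i j = m j i"
    and m_tri: "m i k \<le> m i j + m j k"
    and m_le: "m i j \<le> Mx"
begin

definition V :: "('n \<times> 'n \<times> nat) set" where
  "V = {(i, j, p). to_nat i \<le> to_nat j \<and> p \<le> 2 * m i j}"

text \<open>
  The bead positions have two components. The first one moves at constant speed along the
  edge of a simplex from vertex \<open>i\<close> to vertex \<open>j\<close>. A path with \<open>i = j\<close> has only
  the bead \<open>p = 0\<close>, for which the quotient is \<open>0 / 0 = 0\<close>.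
\<close>

definition simplex_part :: "'n \<times> 'n \<times> nat \<Rightarrow> 'n \<Rightarrow> real" where
  "simplex_part = (\<lambda>(i, j, p) a. (if a = i then 1 - p / (2 * m i j) else 0)
      + (if a = j then p / (2 * m i j) else 0))"

text \<open>
  The second component is the indicator vector of this set. As \<open>p\<close> grows, the set is first
  filled slot by slot up to \<open>m i j\<close> elements and then emptied from below. Thus it runs through
  a closed loop in a cube whose coordinates belong to the path \<open>(i, j)\<close> alone; each step has
  length 1, and squared distances in it are the distances along the loop.
\<close>

definition loop_part :: "'n \<times> 'n \<times> nat \<Rightarrow> ('n \<times> 'n \<times> nat) set" where
  "loop_part = (\<lambda>(i, j, p). {i} \<times> {j} \<times> {p - m i j..<min p (m i j)})"

definition slots :: "('n \<times> 'n \<times> nat) set" where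
  "slots = UNIV \<times> UNIV \<times> {..<Mx}"

definition C :: "('n + 'n \<times> 'n \<times> nat) set" where
  "C = UNIV <+> slots"

text \<open>
  The factor makes the simplex so large that the squared distance of two beads is at least
  \<open>12 * Mx / 4 = 3 * Mx\<close>, a bound for the distance of a bead from a node along the network, once they differ by
  \<open>1 / 2\<close> in a vertex coordinate. If \<open>(m i j)\<^sup>2\<close> is large compared with
  \<open>Mx\<close>, a single step along an edge still adds little to the length 1 of a step of the loop.
\<close>

definition bead :: "'n \<times> 'n \<times> nat \<Rightarrow> 'n + 'n \<times> 'n \<times> nat \<Rightarrow> real" where
  "bead v = case_sum (\<lambda>a. sqrt (12 * Mx) * simplex_part v a) (indicator (loop_part v))"

lemma finite_slots: "finite slots"
  by (simp add: slots_def)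

lemma finite_V: "finite V"
proof (rule finite_subset)
  show "V \<subseteq> UNIV \<times> UNIV \<times> {..2 * Mx}"
  proof
    fix v assume "v \<in> V"
    then obtain i j p where "v = (i, j, p)" "p \<le> 2 * m i j" by (auto simp: V_def)
    thus "v \<in> UNIV \<times> UNIV \<times> {..2 * Mx}" using m_le[of i j] by simp
  qed
qed simp

sublocale background V C bead
  by unfold_locales (simp_all add: finite_V finite_slots C_def)

lemma loop_part_subset: "loop_part v \<subseteq> slots"
proof
  fix s assume "s \<in> loop_part v"
  moreover obtain i j p where "v = (i, j, p)" by (cases v)
  ultimately show "s \<in> slots" using m_le[of i j] by (auto simp: loop_part_def slots_def)
qed

lemma sqdist_bead:
  "sqdist C (bead u) (bead v) = 12 * Mx * (\<Sum>a\<in>UNIV. (simplex_part u a - simplex_part v a)\<^sup>2)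
      + card (loop_part u - loop_part v \<union> (loop_part v - loop_part u))"
proof -
  have "sqdist C (bead u) (bead v) = (\<Sum>a\<in>UNIV. (sqrt (12 * Mx) * simplex_part u a - sqrt (12 * Mx) * simplex_part v a)\<^sup>2)
      + (\<Sum>s\<in>slots. (indicator (loop_part u) s - indicator (loop_part v) s)\<^sup>2)"
    unfolding sqdist_def C_def using finite_slots by (subst sum.Plus) (simp_all add: bead_def)
  also have "(\<Sum>a\<in>UNIV. (sqrt (12 * Mx) * simplex_part u a - sqrt (12 * Mx) * simplex_part v a)\<^sup>2)
      = 12 * Mx * (\<Sum>a\<in>UNIV. (simplex_part u a - simplex_part v a)\<^sup>2)"
    unfolding sum_distrib_left
    by (intro sum.cong refl) (simp add: right_diff_distrib[symmetric] power_mult_distrib)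
  finally show ?thesis
    using sum_indicator_diff_sq[OF finite_slots loop_part_subset loop_part_subset, of u v] by simp
qed

lemma sqdist_step:
  assumes ij: "i \<noteq> j" and p: "p < 2 * m i j"
  shows "sqdist C (bead (i, j, p)) (bead (i, j, Suc p)) = 6 * Mx / (m i j)\<^sup>2 + 1"
proof -
  let ?m = "m i j"
  have m: "?m > 0" using m_pos ij by simp
  have "(\<Sum>a\<in>UNIV. (simplex_part (i, j, p) a - simplex_part (i, j, Suc p) a)\<^sup>2)
      = (\<Sum>a\<in>{i, j}. 1 / (4 * ?m\<^sup>2))"
    using ij m
    by (intro sum.mono_neutral_cong_right) (auto simp: simplex_part_def field_simps power2_eq_square)
  also have "\<dots> = 1 / (2 * ?m\<^sup>2)"
    using ij by simp
  finally have "12 * Mx * (\<Sum>a\<in>UNIV. (simplex_part (i, j, p) a - simplex_part (i, j, Suc p) a)\<^sup>2) = 6 * Mx / ?m\<^sup>2"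
    by simp
  moreover have "loop_part (i, j, p) - loop_part (i, j, Suc p) \<union> (loop_part (i, j, Suc p) - loop_part (i, j, p))
      = {(i, j, if p < ?m then p else p - ?m)}"
    using p m by (auto simp: loop_part_def)
  ultimately show ?thesis unfolding sqdist_bead by simp
qed

definition near_end :: "'n \<times> 'n \<times> nat \<Rightarrow> 'n" where
  "near_end = (\<lambda>(i, j, p). if p \<le> m i j then i else j)"

definition end_gap :: "'n \<times> 'n \<times> nat \<Rightarrow> nat" where
  "end_gap = (\<lambda>(i, j, p). min p (2 * m i j - p))"

text \<open>
  The distance from node \<open>c\<close> along the network, where a bead is reached from either end
  of its path.
\<close>

definition path_dist :: "'n \<Rightarrow> 'n \<times> 'n \<times> nat \<Rightarrow> nat" where
  "path_dist c = (\<lambda>(i, j, p). min (2 * m c i + p) (2 * m c j + (2 * m i j - p)))"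

lemma path_dist_le_bound:
  assumes "v \<in> V"
  shows "path_dist c v \<le> 3 * Mx"
proof -
  obtain i j p where v: "v = (i, j, p)" "p \<le> 2 * m i j" using assms by (auto simp: V_def)
  have "2 * path_dist c v \<le> (2 * m c i + p) + (2 * m c j + (2 * m i j - p))"
    unfolding v path_dist_def by (simp add: min_def)
  thus ?thesis using v(2) m_le[of c i] m_le[of c j] m_le[of i j] by linarith
qed

lemma path_dist_le_near_end: "v \<in> V \<Longrightarrow> path_dist c v \<le> 2 * m c (near_end v) + end_gap v"
  by (auto simp: V_def path_dist_def near_end_def end_gap_def)

lemma near_end_le_path_dist: "v \<in> V \<Longrightarrow> 2 * m c (near_end v) \<le> path_dist c v + end_gap v"
proof -
  assume "v \<in> V"
  then obtain i j p where v: "v = (i, j, p)" "p \<le> 2 * m i j" by (auto simp: V_def)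
  show ?thesis
    using v(2) m_tri[of c i j] m_tri[of c j i] m_sym[of i j]
    unfolding v path_dist_def near_end_def end_gap_def by (auto simp: min_def)
qed

lemma simplex_part_near_end: "v \<in> V \<Longrightarrow> simplex_part v (near_end v) \<ge> 1 / 2"
proof -
  assume "v \<in> V"
  then obtain i j p where v: "v = (i, j, p)" "p \<le> 2 * m i j" by (auto simp: V_def)
  show ?thesis
  proof (cases "i = j")
    case True
    thus ?thesis using v by (simp add: simplex_part_def near_end_def)
  next
    case False
    hence "m i j > 0" by (rule m_pos)
    thus ?thesis using v False by (auto simp: simplex_part_def near_end_def field_simps)
  qed
qed

lemma simplex_part_off_path: "a \<notin> {i, j} \<Longrightarrow> simplex_part (i, j, p) a = 0"
  by (auto simp: simplex_part_def)

lemma card_loop_part: "p \<le> 2 * m i j \<Longrightarrow> card (loop_part (i, j, p)) = end_gap (i, j, p)"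
  by (auto simp: loop_part_def end_gap_def card_cartesian_product min_def)

lemma sqdist_far:
  assumes "\<bar>simplex_part u a - simplex_part v a\<bar> \<ge> 1 / 2" "u \<in> V"
  shows "real (path_dist c u) - real (path_dist c v) \<le> sqdist C (bead u) (bead v)"
proof -
  have "1 / 4 \<le> (simplex_part u a - simplex_part v a)\<^sup>2"
    using power_mono[OF assms(1), of 2] by (simp add: power2_eq_square)
  also have "\<dots> \<le> (\<Sum>a\<in>UNIV. (simplex_part u a - simplex_part v a)\<^sup>2)"
    by (intro member_le_sum) auto
  finally have "12 * Mx * (1 / 4) \<le> 12 * Mx * (\<Sum>a\<in>UNIV. (simplex_part u a - simplex_part v a)\<^sup>2)"
    by (intro mult_left_mono) auto
  hence "3 * Mx \<le> sqdist C (bead u) (bead v)" unfolding sqdist_bead by simp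
  thus ?thesis using path_dist_le_bound[OF assms(2), of c] by linarith
qed

text \<open>
  Between \<open>p\<close> and \<open>q\<close> the slots \<open>p, ..., min q m - 1\<close> are filled and the slots
  \<open>p - m, ..., q - m - 1\<close> are emptied; as long as the two beads are at most half the loop apart,
  no slot is counted twice.
\<close>

lemma card_loop_part_diff:
  assumes pq: "p \<le> q" "q \<le> p + m i j" "q \<le> 2 * m i j"
  shows "q - p \<le> card (loop_part (i, j, p) - loop_part (i, j, q) \<union> (loop_part (i, j, q) - loop_part (i, j, p)))"
proof -
  let ?m = "m i j"
  let ?gain = "{i} \<times> {j} \<times> {p..<min q ?m}" and ?loss = "{i} \<times> {j} \<times> {p - ?m..<q - ?m}"
  have gain: "?gain \<subseteq> loop_part (i, j, q) - loop_part (i, j, p)"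
    using pq by (auto simp: loop_part_def)
  have loss: "?loss \<subseteq> loop_part (i, j, p) - loop_part (i, j, q)"
    using pq by (auto simp: loop_part_def)
  have "q - p = card ?gain + card ?loss"
    using pq(1) by (auto simp: card_cartesian_product min_def)
  also have "\<dots> = card (?loss \<union> ?gain)"
    using gain loss by (subst card_Un_disjoint) auto
  also have "\<dots> \<le> card (loop_part (i, j, p) - loop_part (i, j, q) \<union> (loop_part (i, j, q) - loop_part (i, j, p)))"
    using gain loss by (intro card_mono Un_mono) (auto simp: loop_part_def)
  finally show ?thesis .
qed

lemma path_dist_diff_le_same_path:
  assumes V: "(i, j, p) \<in> V" "(i, j, q) \<in> V"
  shows "real (path_dist c (i, j, p)) - real (path_dist c (i, j, q)) \<le> sqdist C (bead (i, j, p)) (bead (i, j, q))"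
proof -
  let ?m = "m i j" and ?d = "sqdist C (bead (i, j, p)) (bead (i, j, q))"
  have pq: "p \<le> 2 * ?m" "q \<le> 2 * ?m" using V by (auto simp: V_def)
  show ?thesis
  proof (cases "p \<le> q + ?m \<and> q \<le> p + ?m")
    case True
    have "max p q - min p q
        \<le> card (loop_part (i, j, p) - loop_part (i, j, q) \<union> (loop_part (i, j, q) - loop_part (i, j, p)))"
    proof (cases "p \<le> q")
      case le: True
      thus ?thesis using card_loop_part_diff[of p q i j] pq True by (simp add: max_def min_def)
    next
      case False
      thus ?thesis using card_loop_part_diff[of q p i j] pq True
        by (simp add: max_def min_def Un_commute)
    qed
    moreover have "path_dist c (i, j, p) \<le> path_dist c (i, j, q) + (max p q - min p q)"
      using pq by (auto simp: path_dist_def min_def max_def)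
    moreover have "card (loop_part (i, j, p) - loop_part (i, j, q) \<union> (loop_part (i, j, q) - loop_part (i, j, p))) \<le> ?d"
      unfolding sqdist_bead by (simp add: sum_nonneg)
    ultimately show ?thesis by linarith
  next
    case False
    hence m: "?m > 0" using pq by (cases "?m = 0") auto
    hence ij: "i \<noteq> j" by auto
    have "\<bar>real q - real p\<bar> \<ge> ?m" using False by linarith
    hence "\<bar>(real q - real p) / (2 * ?m)\<bar> \<ge> 1 / 2"
      using m by (simp add: abs_divide field_simps)
    moreover have "simplex_part (i, j, p) i - simplex_part (i, j, q) i = (real q - real p) / (2 * ?m)"
      using ij by (simp add: simplex_part_def diff_divide_distrib)
    ultimately show ?thesis using sqdist_far[OF _ V(1)] by metis
  qed
qed

text \<open>
  The central estimate. Beads on different paths that are close to different nodes, and beads more than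
  half a loop apart on the same path, are separated by the simplex. Otherwise the loops suffice: on one path they give the
  distance along it, and on two different paths with a common nearby end their coordinates are
  disjoint, so that the squared distances to that end add up.
\<close>

lemma path_dist_diff_le:
  assumes u: "u \<in> V" and v: "v \<in> V"
  shows "real (path_dist c u) - real (path_dist c v) \<le> sqdist C (bead u) (bead v)"
proof -
  obtain i j p where u': "u = (i, j, p)" "p \<le> 2 * m i j" "to_nat i \<le> to_nat j"
    using u by (auto simp: V_def)
  obtain k l q where v': "v = (k, l, q)" "q \<le> 2 * m k l" "to_nat k \<le> to_nat l"
    using v by (auto simp: V_def)
  have ends: "near_end u \<in> {i, j}" "near_end v \<in> {k, l}"
    by (auto simp: u' v' near_end_def)
  consider "(i, j) = (k, l)" | "(i, j) \<noteq> (k, l)" "near_end u = near_end v"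
    | "near_end u \<notin> {k, l}" | "near_end v \<notin> {i, j}"
  proof -
    have "(i, j) = (k, l)" if "near_end u \<noteq> near_end v" "near_end u \<in> {k, l}" "near_end v \<in> {i, j}"
    proof -
      have "{i, j} = {k, l}" using that ends by auto
      thus ?thesis using u'(3) v'(3) by (auto simp: doubleton_eq_iff)
    qed
    thus ?thesis using that by blast
  qed
  thus ?thesis
  proof cases
    case 1
    thus ?thesis using path_dist_diff_le_same_path u v unfolding u'(1) v'(1) by simp
  next
    case 2
    have "loop_part u \<inter> loop_part v = {}" using 2(1) by (auto simp: u' v' loop_part_def)
    hence "loop_part u - loop_part v \<union> (loop_part v - loop_part u) = loop_part u \<union> loop_part v" by blast
    moreover have "card (loop_part u \<union> loop_part v) = end_gap u + end_gap v"
      using \<open>loop_part u \<inter> loop_part v = {}\<close> u' v'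
      by (subst card_Un_disjoint) (auto simp: card_loop_part finite_subset[OF loop_part_subset finite_slots])
    ultimately have "end_gap u + end_gap v \<le> sqdist C (bead u) (bead v)"
      unfolding sqdist_bead by (simp add: sum_nonneg)
    thus ?thesis using path_dist_le_near_end[OF u, of c] near_end_le_path_dist[OF v, of c, folded 2(2)] by linarith
  next
    case 3
    hence "simplex_part v (near_end u) = 0" unfolding v' by (rule simplex_part_off_path)
    thus ?thesis using simplex_part_near_end[OF u] by (intro sqdist_far[OF _ u, of "near_end u"]) simp
  next
    case 4
    hence "simplex_part u (near_end v) = 0" unfolding u' by (rule simplex_part_off_path)
    thus ?thesis using simplex_part_near_end[OF v] by (intro sqdist_far[OF _ u, of "near_end v"]) simp
  qed
qed

text \<open>
  All paths that meet in a node pass through the same point there, although the node has several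
  names among the beads.
\<close>

lemma bead_start: "bead (i, j, 0) = bead (i, i, 0)"
  by (auto simp: bead_def simplex_part_def loop_part_def fun_eq_iff split: sum.split)

lemma bead_finish: "i \<noteq> j \<Longrightarrow> bead (i, j, 2 * m i j) = bead (j, j, 0)"
  using m_pos[of i j] by (auto simp: bead_def simplex_part_def loop_part_def fun_eq_iff split: sum.split)

text \<open>
  The squared distance between the configurations whose extra particle sits in node \<open>i\<close> and in
  node \<open>j\<close>. By the following lemmas it is nearly \<open>2 * m i j\<close>.
\<close>

definition dist2 :: "'n \<Rightarrow> 'n \<Rightarrow> real" where
  "dist2 i j = (conf.orb_dist (config (bead (i, i, 0))) (config (bead (j, j, 0))))\<^sup>2"

lemma dist2_ge: "2 * m i j \<le> dist2 i j"
proof -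
  have "real (path_dist j (i, i, 0)) - real (path_dist j (j, j, 0)) \<le> dist2 i j"
    unfolding dist2_def
    by (rule potential_le_config_dist[where \<phi> = "\<lambda>v. real (path_dist j v)"], simp add: V_def,
        simp add: V_def, rule path_dist_diff_le)
  thus ?thesis by (simp add: path_dist_def m_sym[of j i])
qed

lemma dist2_self: "dist2 i i = 0"
  using config_dist_le_chain[of "\<lambda>_. (i, i, 0)" 0] by (simp add: dist2_def V_def)

lemma dist2_le:
  assumes ij: "i \<noteq> j"
  shows "dist2 i j \<le> 2 * m i j + 12 * Mx / m i j"
proof -
  have oriented: "dist2 i j \<le> 2 * m i j + 12 * Mx / m i j"
    if ij: "i \<noteq> j" "to_nat i \<le> to_nat j" for i j
  proof -
    let ?m = "m i j"
    have m: "?m > 0" using ij(1) by (rule m_pos)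
    have "dist2 i j = (conf.orb_dist (config (bead (i, j, 0))) (config (bead (i, j, 2 * ?m))))\<^sup>2"
      unfolding dist2_def bead_start[of i j] bead_finish[OF ij(1)] by (rule refl)
    also have "\<dots> \<le> (\<Sum>k<2 * ?m. sqdist C (bead (i, j, k)) (bead (i, j, Suc k)))"
      using config_dist_le_chain[of "\<lambda>k. (i, j, k)" "2 * ?m"] ij(2) by (auto simp: inj_on_def V_def)
    also have "\<dots> = (\<Sum>k<2 * ?m. 6 * Mx / ?m\<^sup>2 + 1)"
      using ij(1) by (intro sum.cong refl sqdist_step) auto
    also have "\<dots> = 2 * ?m + 12 * Mx / ?m"
      using m by (simp add: field_simps power2_eq_square)
    finally show ?thesis .
  qed
  show ?thesis
  proof (cases "to_nat i \<le> to_nat j")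
    case False
    have "dist2 i j = dist2 j i" unfolding dist2_def by (subst conf.Q.commute) (rule refl)
    thus ?thesis using oriented[of j i] False ij m_sym[of i j] by simp
  qed (use oriented ij in blast)
qed

end


section \<open>From integer metrics to arbitrary metrics\<close>

text \<open>
  Rounding up preserves the triangle inequality. Adding \<open>k\<close> to all distances between different
  indices preserves it as well and keeps every path long, even if some of the points coincide, while
  its effect vanishes after division by \<open>k\<^sup>2\<close>.
\<close>

lemma network_rounded_metric:
  fixes x :: "'n::finite \<Rightarrow> 'a" and k b :: nat
  assumes X: "Metric_space X d" and x: "\<And>i. x i \<in> X" and k: "0 < k"
    and b: "\<And>i j. d (x i) (x j) \<le> b"
  shows "network (\<lambda>i j. if i = j then 0 else nat \<lceil>(real k)\<^sup>2 * d (x i) (x j)\<rceil> + k) (k\<^sup>2 * b + k)"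
proof
  interpret Metric_space X d by (rule X)
  let ?r = "\<lambda>i j. nat \<lceil>(real k)\<^sup>2 * d (x i) (x j)\<rceil>"
  fix i j l :: 'n
  show "i \<noteq> j \<Longrightarrow> 0 < (if i = j then 0 else ?r i j + k)" using k by simp
  show "(if i = j then 0 else ?r i j + k) = (if j = i then 0 else ?r j i + k)"
    using commute[of "x i" "x j"] by simp
  have "?r i l \<le> ?r i j + ?r j l"
  proof -
    have "\<lceil>(real k)\<^sup>2 * d (x i) (x l)\<rceil> \<le> \<lceil>(real k)\<^sup>2 * d (x i) (x j) + (real k)\<^sup>2 * d (x j) (x l)\<rceil>"
      using triangle[OF x x x, of i l j]
      by (intro ceiling_mono) (simp add: distrib_left[symmetric] mult_left_mono)
    also have "\<dots> \<le> \<lceil>(real k)\<^sup>2 * d (x i) (x j)\<rceil> + \<lceil>(real k)\<^sup>2 * d (x j) (x l)\<rceil>"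
      by (rule ceiling_add_le)
    finally show ?thesis by linarith
  qed
  thus "(if i = l then 0 else ?r i l + k)
      \<le> (if i = j then 0 else ?r i j + k) + (if j = l then 0 else ?r j l + k)"
    by simp
  have "(real k)\<^sup>2 * d (x i) (x j) \<le> (real k)\<^sup>2 * b"
    using b by (intro mult_left_mono) simp_all
  also have "\<dots> = real_of_int (int (k\<^sup>2 * b))" by simp
  finally have "\<lceil>(real k)\<^sup>2 * d (x i) (x j)\<rceil> \<le> int (k\<^sup>2 * b)" by (simp only: ceiling_le_iff)
  hence "?r i j \<le> k\<^sup>2 * b" by linarith
  thus "(if i = j then 0 else ?r i j + k) \<le> k\<^sup>2 * b + k" by simp
qed simp

text \<open>
  The quantity \<open>dist2 i j / (2 * k\<^sup>2)\<close> is at least the given distance, which is used with the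
  weights \<open>A\<close>, and exceeds it by at most \<open>O(1 / k)\<close>, which is used with the weights
  \<open>B\<close>.
\<close>

lemma approximate_inequality:
  fixes A B :: "real ^ 'n ^ 'n" and x :: "'n \<Rightarrow> 'a" and k b :: nat
  assumes A: "\<And>i j. 0 \<le> A $ i $ j" and B: "\<And>i j. 0 \<le> B $ i $ j"
    and AB: "alexandrov_quadratic_inequality A B"
    and X: "Metric_space X d" and x: "\<And>i. x i \<in> X" and k: "0 < k"
    and b: "\<And>i j. d (x i) (x j) \<le> b"
  shows "(\<Sum>i\<in>UNIV. \<Sum>j\<in>UNIV. A $ i $ j * d (x i) (x j))
      \<le> (\<Sum>i\<in>UNIV. \<Sum>j\<in>UNIV. B $ i $ j * d (x i) (x j))
        + (\<Sum>i\<in>UNIV. \<Sum>j\<in>UNIV. B $ i $ j) * (8 + 6 * b) / k"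
proof -
  interpret Metric_space X d by (rule X)
  define m where "m i j = (if i = j then 0 else nat \<lceil>(real k)\<^sup>2 * d (x i) (x j)\<rceil> + k)" for i j
  interpret network m "k\<^sup>2 * b + k"
    unfolding m_def by (rule network_rounded_metric[OF X x k b])
  have k1: "real k \<ge> 1" using k by simp
  have lower: "d (x i) (x j) \<le> dist2 i j / (2 * (real k)\<^sup>2)" for i j
  proof (cases "i = j")
    case True
    thus ?thesis using x by (simp add: dist2_self)
  next
    case False
    have "(real k)\<^sup>2 * d (x i) (x j) \<le> m i j" using False by (simp add: m_def) linarith
    hence "2 * (real k)\<^sup>2 * d (x i) (x j) \<le> dist2 i j" using dist2_ge[of i j] by linarith
    thus ?thesis using k by (simp add: field_simps)
  qed
  have upper: "dist2 i j / (2 * (real k)\<^sup>2) \<le> d (x i) (x j) + (8 + 6 * b) / k" for i j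
  proof (cases "i = j")
    case True
    thus ?thesis using x by (simp add: dist2_self)
  next
    case False
    have mk: "m i j \<ge> k" using False by (simp add: m_def)
    have "0 \<le> (real k)\<^sup>2 * d (x i) (x j)" by simp
    hence m_le': "m i j \<le> (real k)\<^sup>2 * d (x i) (x j) + 1 + k"
      using False by (simp add: m_def)
    have D_le: "dist2 i j \<le> 2 * real (m i j) + 12 * real (k\<^sup>2 * b + k) / m i j"
      using dist2_le[OF False] by (simp only: of_nat_mult of_nat_numeral)
    have "real (k\<^sup>2 * b + k) / m i j \<le> real (k\<^sup>2 * b + k) / k"
      using mk k by (intro divide_left_mono mult_pos_pos) simp_all
    also have "\<dots> = k * b + 1" using k by (simp add: field_simps power2_eq_square)
    finally have M_le: "12 * (real (k\<^sup>2 * b + k) / m i j) \<le> 12 * real (k * b + 1)"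
      by (intro mult_left_mono) simp_all
    have "dist2 i j \<le> 2 * ((real k)\<^sup>2 * d (x i) (x j) + 1 + k) + 12 * real (k * b + 1)"
      using M_le unfolding times_divide_eq_right
      by (intro order_trans[OF D_le add_mono] mult_left_mono m_le') simp_all
    also have "\<dots> \<le> 2 * (real k)\<^sup>2 * d (x i) (x j) + 2 * k * (8 + 6 * b)"
      using k1 by (simp add: algebra_simps)
    also have "\<dots> = (d (x i) (x j) + (8 + 6 * b) / k) * (2 * (real k)\<^sup>2)"
      using k by (simp add: field_simps power2_eq_square)
    finally show ?thesis using k by (subst pos_divide_le_eq) simp_all
  qed
  have "(\<Sum>i\<in>UNIV. \<Sum>j\<in>UNIV. A $ i $ j * d (x i) (x j))
      \<le> (\<Sum>i\<in>UNIV. \<Sum>j\<in>UNIV. A $ i $ j * (dist2 i j / (2 * (real k)\<^sup>2)))"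
    by (intro sum_mono mult_left_mono lower A)
  also have "\<dots> = (\<Sum>i\<in>UNIV. \<Sum>j\<in>UNIV. A $ i $ j * dist2 i j) / (2 * (real k)\<^sup>2)"
    by (simp add: sum_divide_distrib)
  also have "\<dots> \<le> (\<Sum>i\<in>UNIV. \<Sum>j\<in>UNIV. B $ i $ j * dist2 i j) / (2 * (real k)\<^sup>2)"
    unfolding dist2_def
    by (intro divide_right_mono quadratic_inequality_config[OF AB, of "\<lambda>i. (i, i, 0)"]) simp
  also have "\<dots> = (\<Sum>i\<in>UNIV. \<Sum>j\<in>UNIV. B $ i $ j * (dist2 i j / (2 * (real k)\<^sup>2)))"
    by (simp add: sum_divide_distrib)
  also have "\<dots> \<le> (\<Sum>i\<in>UNIV. \<Sum>j\<in>UNIV. B $ i $ j * (d (x i) (x j) + (8 + 6 * b) / k))"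
    by (intro sum_mono mult_left_mono upper B)
  also have "\<dots> = (\<Sum>i\<in>UNIV. \<Sum>j\<in>UNIV. B $ i $ j * d (x i) (x j))
        + (\<Sum>i\<in>UNIV. \<Sum>j\<in>UNIV. B $ i $ j) * ((8 + 6 * b) / k)"
    by (simp only: distrib_left sum.distrib sum_distrib_right)
  finally show ?thesis by simp
qed

theorem theorem6:
  fixes A B :: "real ^ 'n ^ 'n"
    and X :: "'a set" and d :: "'a \<Rightarrow> 'a \<Rightarrow> real" and x :: "'n \<Rightarrow> 'a"
  assumes "\<And>i j. 0 \<le> A $ i $ j"
    and "\<And>i j. 0 \<le> B $ i $ j"
    and "alexandrov_quadratic_inequality A B"
    and "Metric_space X d"
    and "\<And>i. x i \<in> X"
  shows "(\<Sum>i\<in>UNIV. \<Sum>j\<in>UNIV. A $ i $ j * d (x i) (x j))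
         \<le> (\<Sum>i\<in>UNIV. \<Sum>j\<in>UNIV. B $ i $ j * d (x i) (x j))"
proof -
  define r where "r = Max (range (\<lambda>(i, j). d (x i) (x j)))"
  have r: "d (x i) (x j) \<le> r" for i j
    unfolding r_def by (rule Max_ge) (auto intro: range_eqI[of _ _ "(i, j)"])
  obtain b :: nat where "r \<le> b" using real_arch_simple by blast
  hence b: "d (x i) (x j) \<le> b" for i j using r order_trans by blast
  let ?SA = "\<Sum>i\<in>UNIV. \<Sum>j\<in>UNIV. A $ i $ j * d (x i) (x j)"
  let ?SB = "\<Sum>i\<in>UNIV. \<Sum>j\<in>UNIV. B $ i $ j * d (x i) (x j)"
  let ?c = "(\<Sum>i\<in>UNIV. \<Sum>j\<in>UNIV. B $ i $ j) * (8 + 6 * b)"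
  have "(\<lambda>k. ?SB + ?c / real k) \<longlonglongrightarrow> ?SB + 0"
    by (intro tendsto_add tendsto_const lim_const_over_n)
  moreover have "?SA \<le> ?SB + ?c / real k" if "k \<ge> 1" for k
    using approximate_inequality[OF assms(1-5), where k = k and b = b] b that by simp
  ultimately have "?SA \<le> ?SB + 0"
    by (intro LIMSEQ_le_const) blast+
  thus ?thesis by simp
qed

end
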